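(* Let $f\colon\mathbb{R}^{n\times n}\to\mathbb{R}$ be a differentiable function and let $\exp\colon\mathbb{R}^{n\times n}\to\mathbb{R}^{n\times n}$ be the matrix exponential. Then for every $A\in\mathbb{R}^{n\times n}$, \[ \nabla(f\circ\exp)(A) = (\mathrm{d}\exp)_{A^{\intercal}}\bigl(\nabla f(e^{A})\bigr). \]
   Context: Gradients are taken with respect to the canonical inner product $\langle A_1,A_2\rangle=\operatorname{tr}(A_1^{\intercal}A_2)$ on $\mathbb{R}^{n\times n}$. $(\mathrm{d}\exp)_X\colon\mathbb{R}^{n\times n}\to\mathbb{R}^{n\times n}$ denotes the (Fréchet) differential of the matrix exponential at $X$, and $e^A=\exp(A)$. *)

theory Defs
  imports "HOL-Analysis.Analysis"
begin

(* The type real^'n^'n carries only the entrywise multiplication in the library, so neither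
   the overloaded power nor the overloaded exp gives the matrix one. The k-th matrix power is
   therefore the k-fold iterate of left matrix multiplication, applied to the identity. *)
definition matrix_exp :: "real^'n^'n \<Rightarrow> real^'n^'n" where
  "matrix_exp A = (\<Sum>k. (1 / fact k) *\<^sub>R (((**) A) ^^ k) (mat 1))"

(* The inner product of the library on real^'n^'n is the canonical (Frobenius) one. *)
lemma inner_matrix_eq_trace:
  fixes A B :: "real^'n^'n"
  shows "A \<bullet> B = trace (transpose A ** B)"
proof -
  have "A \<bullet> B = (\<Sum>i\<in>UNIV. \<Sum>j\<in>UNIV. A$i$j * B$i$j)"
    by (simp add: inner_vec_def)
  also have "\<dots> = (\<Sum>j\<in>UNIV. \<Sum>i\<in>UNIV. A$i$j * B$i$j)"
    by (rule sum.swap)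
  finally show ?thesis
    by (simp add: trace_def matrix_matrix_mult_def transpose_def)
qed

lemma norm_matrix_mult_le:
  fixes A B :: "real^'n^'n"
  shows "norm (A ** B) \<le> norm A * norm B"
proof -
  have sq: "(norm M)\<^sup>2 = (\<Sum>i\<in>UNIV. (norm (M$i))\<^sup>2)" for M :: "real^'n^'n"
    unfolding power2_norm_eq_inner by (rule inner_vec_def)
  have sq_entries: "(norm M)\<^sup>2 = (\<Sum>i\<in>UNIV. \<Sum>j\<in>UNIV. (M$i$j)\<^sup>2)" for M :: "real^'n^'n"
    unfolding power2_norm_eq_inner inner_vec_def by (simp add: power2_eq_square)
  have norm_col: "(norm (column j B))\<^sup>2 = (\<Sum>i\<in>UNIV. (B$i$j)\<^sup>2)" for j
    unfolding power2_norm_eq_inner inner_vec_def by (simp add: column_def power2_eq_square)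
  have entry: "(A ** B)$i$j = (A$i) \<bullet> column j B" for i j
    by (simp add: matrix_matrix_mult_def inner_vec_def column_def)
  have "(norm (A ** B))\<^sup>2 = (\<Sum>i\<in>UNIV. \<Sum>j\<in>UNIV. ((A$i) \<bullet> column j B)\<^sup>2)"
    by (simp add: sq_entries entry)
  also have "\<dots> \<le> (\<Sum>i\<in>UNIV. \<Sum>j\<in>UNIV. (norm (A$i))\<^sup>2 * (norm (column j B))\<^sup>2)"
    unfolding power2_norm_eq_inner by (intro sum_mono Cauchy_Schwarz_ineq)
  also have "\<dots> = (norm A)\<^sup>2 * (\<Sum>j\<in>UNIV. (norm (column j B))\<^sup>2)"
    unfolding sq[of A] by (rule sum_product [symmetric])
  also have "(\<Sum>j\<in>UNIV. (norm (column j B))\<^sup>2) = (norm B)\<^sup>2"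
    unfolding norm_col sq_entries by (rule sum.swap)
  finally have "(norm (A ** B))\<^sup>2 \<le> (norm A * norm B)\<^sup>2"
    by (simp only: power_mult_distrib)
  then show ?thesis
    by (rule power2_le_imp_le) simp
qed

lemma matrix_exp_sums:
  fixes A :: "real^'n^'n"
  shows "(\<lambda>k. (1 / fact k) *\<^sub>R (((**) A) ^^ k) (mat 1)) sums matrix_exp A"
proof -
  have pow: "norm ((((**) A) ^^ k) (mat 1)) \<le> norm A ^ k * norm (mat 1 :: real^'n^'n)" for k
  proof (induction k)
    case (Suc k)
    have "norm ((((**) A) ^^ Suc k) (mat 1)) \<le> norm A * norm ((((**) A) ^^ k) (mat 1))"
      by (simp add: norm_matrix_mult_le)
    also have "\<dots> \<le> norm A * (norm A ^ k * norm (mat 1 :: real^'n^'n))"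
      using Suc by (intro mult_left_mono) auto
    finally show ?case by (simp add: mult.assoc)
  qed simp
  have "summable (\<lambda>k. inverse (fact k) * norm A ^ k * norm (mat 1 :: real^'n^'n))"
    by (intro summable_mult2 summable_exp)
  moreover have "norm ((1 / fact k) *\<^sub>R (((**) A) ^^ k) (mat 1))
      \<le> inverse (fact k) * norm A ^ k * norm (mat 1 :: real^'n^'n)" for k
    using mult_left_mono [OF pow [of k], of "inverse (fact k)"]
    by (simp add: inverse_eq_divide mult.assoc)
  ultimately have "summable (\<lambda>k. (1 / fact k) *\<^sub>R (((**) A) ^^ k) (mat 1))"
    by (rule summable_comparison_test')
  then show ?thesis
    unfolding matrix_exp_def by (rule summable_sums)
qed

definition gradient :: "('a::real_inner \<Rightarrow> real) \<Rightarrow> 'a \<Rightarrow> 'a" where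
  "gradient f x = (THE D. GDERIV f x :> D)"

lemma gradient_eqI:
  assumes "GDERIV f x :> D"
  shows "gradient f x = D"
  unfolding gradient_def
proof (rule the_equality)
  show "E = D" if "GDERIV f x :> E" for E
  proof -
    have "(\<lambda>h. inner h E) = (\<lambda>h. inner h D)"
      using that assms unfolding gderiv_def by (rule has_derivative_unique)
    then have "inner h E = inner h D" for h
      by (rule fun_cong)
    then have "inner (E - D) (E - D) = 0"
      by (simp only: inner_diff_right diff_self)
    then show ?thesis
      by simp
  qed
qed (fact assms)

lemma GDERIV_gradient:
  fixes f :: "'a::euclidean_space \<Rightarrow> real"
  assumes "f differentiable (at x)"
  shows "GDERIV f x :> gradient f x"
proof -
  obtain f' where f': "(f has_derivative f') (at x)"
    using assms by (auto simp: differentiable_def)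
  interpret f': bounded_linear f'
    using f' by (rule has_derivative_bounded_linear)
  have "f' h = h \<bullet> (\<Sum>b\<in>Basis. f' b *\<^sub>R b)" for h
  proof -
    have "f' h = f' (\<Sum>b\<in>Basis. (h \<bullet> b) *\<^sub>R b)"
      by (simp add: euclidean_representation)
    also have "\<dots> = (\<Sum>b\<in>Basis. (h \<bullet> b) * f' b)"
      by (simp add: f'.sum f'.scaleR)
    finally show ?thesis
      by (simp add: inner_sum_right mult.commute)
  qed
  then have "f' = (\<lambda>h. h \<bullet> (\<Sum>b\<in>Basis. f' b *\<^sub>R b))"
    by (rule ext)
  with f' have "GDERIV f x :> (\<Sum>b\<in>Basis. f' b *\<^sub>R b)"
    unfolding gderiv_def by (rule back_subst)
  moreover from this have "gradient f x = (\<Sum>b\<in>Basis. f' b *\<^sub>R b)"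
    by (rule gradient_eqI)
  ultimately show ?thesis
    by (simp only:)
qed

end

theory Submission
  imports Defs
begin

text \<open>Differentiating the exponential series termwise expresses \<open>(d exp)\<^sub>X H\<close> as a sum of multiples of
  the words \<open>X\<^sup>i H X\<^sup>j\<close>. The adjoint of \<open>H \<mapsto> X\<^sup>i H X\<^sup>j\<close> is the same map with \<open>X\<close> replaced by its
  transpose, so the adjoint of \<open>(d exp)\<^sub>A\<close> is the differential at the transpose of \<open>A\<close>; the gradient
  formula is then the chain rule.\<close>

abbreviation matrix_power :: "real^'n^'n \<Rightarrow> nat \<Rightarrow> real^'n^'n" where
  "matrix_power X k \<equiv> (((**) X) ^^ k) (mat 1)"

text \<open>The recursion is the product rule for \<open>X ** matrix_power X k\<close>. Unrolled, it
  gives the sum of the words \<open>X^i H X^j\<close> over \<open>i + j = k - 1\<close>.\<close>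

primrec matrix_power_deriv :: "nat \<Rightarrow> real^'n^'n \<Rightarrow> real^'n^'n \<Rightarrow> real^'n^'n" where
  "matrix_power_deriv 0 X H = 0"
| "matrix_power_deriv (Suc k) X H = H ** matrix_power X k + X ** matrix_power_deriv k X H"

definition matrix_exp_deriv :: "real^'n^'n \<Rightarrow> real^'n^'n \<Rightarrow> real^'n^'n" where
  "matrix_exp_deriv X H = (\<Sum>k. (1 / fact k) *\<^sub>R matrix_power_deriv k X H)"

lemma bounded_bilinear_matrix_mult:
  "bounded_bilinear ((**) :: real^'n^'n \<Rightarrow> real^'n^'n \<Rightarrow> real^'n^'n)"
proof
  show "\<exists>K. \<forall>(A :: real^'n^'n) (B :: real^'n^'n). norm (A ** B) \<le> norm A * norm B * K"
    by (intro exI[of _ 1]) (simp add: norm_matrix_mult_le)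
qed (simp_all add: vec_eq_iff matrix_matrix_mult_def algebra_simps sum.distrib sum_distrib_left)

lemma has_derivative_matrix_power:
  "((\<lambda>X. matrix_power X k) has_derivative matrix_power_deriv k X) (at X within S)"
proof (induction k)
  case 0
  show ?case by simp
next
  case (Suc k)
  have "((\<lambda>Y. Y ** matrix_power Y k) has_derivative
      (\<lambda>H. X ** matrix_power_deriv k X H + H ** matrix_power X k)) (at X within S)"
    by (rule bounded_bilinear.FDERIV[OF bounded_bilinear_matrix_mult has_derivative_ident Suc])
  then show ?case by (simp add: add.commute)
qed

lemma norm_matrix_power_le:
  fixes X :: "real^'n^'n"
  assumes "norm X \<le> R"
  shows "norm (matrix_power X k) \<le> R ^ k * norm (mat 1 :: real^'n^'n)"
proof (induction k)
  case (Suc k)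
  have "norm (matrix_power X (Suc k)) \<le> norm X * norm (matrix_power X k)"
    by (simp add: norm_matrix_mult_le)
  also have "\<dots> \<le> R * (R ^ k * norm (mat 1 :: real^'n^'n))"
    using assms Suc order_trans[OF norm_ge_zero assms] by (intro mult_mono) auto
  finally show ?case by (simp add: mult.assoc)
qed simp

text \<open>There are \<open>k\<close> words, each with \<open>k - 1\<close> factors
  \<open>X\<close>. The Frobenius norm of the identity is not 1 in general, so it stays as a
  constant. Bounding by \<open>R\<close> instead of \<open>norm X\<close> makes the estimate uniform
  on a ball.\<close>

lemma norm_matrix_power_deriv_le:
  fixes X H :: "real^'n^'n"
  assumes "norm X \<le> R"
  shows "norm (matrix_power_deriv k X H)
    \<le> real k * R ^ (k - 1) * norm (mat 1 :: real^'n^'n) * norm H"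
proof (induction k)
  case (Suc k)
  let ?c = "norm (mat 1 :: real^'n^'n)"
  have R: "R \<ge> 0" using order_trans[OF norm_ge_zero assms] .
  have "norm (matrix_power_deriv (Suc k) X H)
      \<le> norm H * norm (matrix_power X k) + norm X * norm (matrix_power_deriv k X H)"
    by (simp add: norm_triangle_le add_mono norm_matrix_mult_le)
  also have "\<dots> \<le> norm H * (R ^ k * ?c) + R * (real k * R ^ (k - 1) * ?c * norm H)"
    using assms Suc R norm_matrix_power_le[OF assms, of k]
    by (intro add_mono mult_mono) auto
  \<comment> \<open>For \<open>k = 0\<close> the subtraction in \<open>k - 1\<close> truncates, but
    the factor \<open>real k\<close> vanishes; otherwise
    \<open>R * R ^ (k - 1) = R ^ k\<close>.\<close>
  also have "\<dots> = real (Suc k) * R ^ (Suc k - 1) * ?c * norm H"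
    by (cases k) (simp_all add: algebra_simps)
  finally show ?case .
qed simp

text \<open>Since \<open>k / fact k = 1 / fact (k - 1)\<close> for positive \<open>k\<close>,
  shifting the index by one leaves a multiple of the exponential series.\<close>

lemma summable_matrix_power_deriv_bound:
  fixes R c :: real
  shows "summable (\<lambda>k. (1 / fact k) * (real k * R ^ (k - 1) * c))"
proof (subst summable_Suc_iff[symmetric])
  have "(1 / fact (Suc k)) * (real (Suc k) * R ^ (Suc k - 1) * c) = inverse (fact k) * R ^ k * c"
    for k
    by (simp add: field_simps del: of_nat_Suc)
  then show "summable (\<lambda>k. (1 / fact (Suc k)) * (real (Suc k) * R ^ (Suc k - 1) * c))"
    by (simp only:) (intro summable_mult2 summable_exp)
qed

lemma norm_exp_term_deriv_le:
  fixes X H :: "real^'n^'n"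
  assumes "norm X \<le> R"
  shows "norm ((1 / fact k) *\<^sub>R matrix_power_deriv k X H)
    \<le> (1 / fact k) * (real k * R ^ (k - 1) * norm (mat 1 :: real^'n^'n)) * norm H"
  using mult_left_mono[OF norm_matrix_power_deriv_le[OF assms, of k H], of "1 / fact k"]
  by (simp add: mult.assoc)

lemma matrix_exp_deriv_sums:
  fixes X H :: "real^'n^'n"
  shows "(\<lambda>k. (1 / fact k) *\<^sub>R matrix_power_deriv k X H) sums matrix_exp_deriv X H"
  unfolding matrix_exp_deriv_def
  by (intro summable_sums summable_comparison_test'
      [OF summable_mult2[OF summable_matrix_power_deriv_bound] norm_exp_term_deriv_le[OF order_refl]])

text \<open>Termwise differentiation on a ball around 0: the Weierstrass M-test makes the series of
  derivatives converge uniformly there in operator norm.\<close>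

lemma has_derivative_matrix_exp:
  fixes X :: "real^'n^'n"
  shows "(matrix_exp has_derivative matrix_exp_deriv X) (at X)"
proof -
  \<comment> \<open>Any radius above \<open>norm X\<close> would do: \<open>X\<close> must be an
    interior point of \<open>S\<close>.\<close>
  define R where "R = norm X + 1"
  define S where "S = ball (0 :: real^'n^'n) R"
  define t where "t = (\<lambda>k (Y :: real^'n^'n) H. (1 / fact k) *\<^sub>R matrix_power_deriv k Y H)"
  define M where "M = (\<lambda>k. (1 / fact k) * (real k * R ^ (k - 1) * norm (mat 1 :: real^'n^'n)))"
  have X: "X \<in> S" and "open S" and "convex S"
    by (auto simp: S_def R_def)
  have M: "summable M"
    unfolding M_def by (rule summable_matrix_power_deriv_bound)
  have t_le: "norm (t k Y H) \<le> M k * norm H" if "Y \<in> S" for k Y H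
    using that norm_exp_term_deriv_le[of Y R k H] by (simp add: S_def t_def M_def)
  have t_sums: "t' sums matrix_exp_deriv Y H" if "t' = (\<lambda>k. t k Y H)" for t' Y H
    unfolding that t_def by (rule matrix_exp_deriv_sums)
  have unif: "\<forall>\<^sub>F n in sequentially. \<forall>Y\<in>S. \<forall>H.
      norm ((\<Sum>k<n. t k Y H) - matrix_exp_deriv Y H) \<le> e * norm H" if "e > 0" for e
  proof -
    \<comment> \<open>The tail of \<open>M\<close> depends on neither \<open>Y\<close> nor
      \<open>H\<close>, so one \<open>N\<close> serves all of them.\<close>
    obtain N where N: "\<And>n. n \<ge> N \<Longrightarrow> norm (\<Sum>k. M (k + n)) < e"
      using suminf_exist_split[OF \<open>e > 0\<close> M] by auto
    have "norm ((\<Sum>k<n. t k Y H) - matrix_exp_deriv Y H) \<le> e * norm H"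
      if "n \<ge> N" "Y \<in> S" for n Y H
    proof -
      have sm: "summable (\<lambda>k. M (k + n) * norm H)"
        by (intro summable_mult2 summable_ignore_initial_segment M)
      have "matrix_exp_deriv Y H - (\<Sum>k<n. t k Y H) = (\<Sum>k. t (k + n) Y H)"
        using sums_split_initial_segment[OF t_sums[OF refl, of Y H], of n] by (simp add: sums_iff)
      then have "norm ((\<Sum>k<n. t k Y H) - matrix_exp_deriv Y H) = norm (\<Sum>k. t (k + n) Y H)"
        by (metis norm_minus_commute)
      also have "\<dots> \<le> (\<Sum>k. M (k + n) * norm H)"
        by (intro norm_suminf_le t_le sm that)
      also have "\<dots> = (\<Sum>k. M (k + n)) * norm H"
        by (intro suminf_mult2[symmetric] summable_ignore_initial_segment M)
      also have "\<dots> \<le> e * norm H"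
        using N[OF \<open>n \<ge> N\<close>] by (intro mult_right_mono) auto
      finally show ?thesis .
    qed
    then show ?thesis
      by (auto simp: eventually_sequentially)
  qed
  have "((\<lambda>Y. (1 / fact k) *\<^sub>R matrix_power Y k) has_derivative t k Y) (at Y within S)" for k Y
    unfolding t_def by (intro has_derivative_scaleR_right has_derivative_matrix_power)
  \<comment> \<open>Termwise differentiation only yields some limit function \<open>g\<close>;
    uniqueness of sums identifies it with \<open>matrix_exp\<close> on \<open>S\<close>, and
    openness of \<open>S\<close> removes the restriction to \<open>S\<close>.\<close>
  then obtain g where g: "\<And>Y. Y \<in> S \<Longrightarrow> (\<lambda>k. (1 / fact k) *\<^sub>R matrix_power Y k) sums g Y"
      "\<And>Y. Y \<in> S \<Longrightarrow> (g has_derivative matrix_exp_deriv Y) (at Y within S)"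
    using has_derivative_series[where f = "\<lambda>k Y. (1 / fact k) *\<^sub>R matrix_power Y k",
        OF \<open>convex S\<close> _ unif X matrix_exp_sums] by blast
  have eq: "g Y = matrix_exp Y" if "Y \<in> S" for Y
    using sums_unique2[OF g(1)[OF that] matrix_exp_sums] .
  have "(g has_derivative matrix_exp_deriv X) (at X)"
    using g(2)[OF X] at_within_open[OF X \<open>open S\<close>] by simp
  then show ?thesis
    by (rule has_derivative_transform_within_open[OF _ \<open>open S\<close> X eq])
qed

lemma inner_matrix_mult_left:
  fixes X H G :: "real^'n^'n"
  shows "(X ** H) \<bullet> G = H \<bullet> (transpose X ** G)"
  by (simp add: inner_matrix_eq_trace matrix_transpose_mul matrix_mul_assoc)

lemma inner_transpose_transpose:
  fixes H G :: "real^'n^'n"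
  shows "transpose H \<bullet> transpose G = H \<bullet> G"
  by (simp add: inner_vec_def transpose_def) (rule sum.swap)

text \<open>Transposition preserves the inner product and turns right multiplication into left
  multiplication.\<close>

lemma inner_matrix_mult_right:
  fixes X H G :: "real^'n^'n"
  shows "(H ** X) \<bullet> G = H \<bullet> (G ** transpose X)"
  using inner_matrix_mult_left[of "transpose X" "transpose H" "transpose G"]
    inner_transpose_transpose[of "H ** X" G] inner_transpose_transpose[of H "G ** transpose X"]
  by (simp add: matrix_transpose_mul)

text \<open>Transposing a power reverses its factors, so the new factor appears on the right and has
  to be moved back to the left.\<close>

lemma matrix_power_commute: "matrix_power X k ** X = X ** matrix_power X k"
  by (induction k) (simp_all flip: matrix_mul_assoc)

lemma transpose_matrix_power: "transpose (matrix_power X k) = matrix_power (transpose X) k"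
  by (induction k) (simp_all add: transpose_mat matrix_transpose_mul matrix_power_commute)

text \<open>In each word, \<open>X^i (X H) X^j = X (X^i H X^j)\<close>.\<close>

lemma matrix_power_deriv_mult_left:
  "matrix_power_deriv k X (X ** H) = X ** matrix_power_deriv k X H"
  by (induction k) (simp_all add: matrix_add_ldistrib matrix_mul_assoc)

lemma inner_matrix_power_deriv:
  "matrix_power_deriv k X H \<bullet> G = H \<bullet> matrix_power_deriv k (transpose X) G"
\<comment> \<open>\<open>G\<close> is generalized because the induction hypothesis is applied to
  \<open>transpose X ** G\<close>.\<close>
proof (induction k arbitrary: G)
  case (Suc k)
  have "(X ** matrix_power_deriv k X H) \<bullet> G
      = H \<bullet> (transpose X ** matrix_power_deriv k (transpose X) G)"
    by (simp only: inner_matrix_mult_left Suc matrix_power_deriv_mult_left)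
  moreover have "(H ** matrix_power X k) \<bullet> G = H \<bullet> (G ** matrix_power (transpose X) k)"
    by (simp only: inner_matrix_mult_right transpose_matrix_power)
  ultimately show ?case
    by (simp add: inner_add_left inner_add_right)
qed simp

lemma inner_matrix_exp_deriv:
  "matrix_exp_deriv X H \<bullet> G = H \<bullet> matrix_exp_deriv (transpose X) G"
\<comment> \<open>The inner product is continuous in each argument, so both sides are sums of the
  same real series.\<close>
proof (rule sums_unique2)
  show "(\<lambda>k. ((1 / fact k) *\<^sub>R matrix_power_deriv k X H) \<bullet> G) sums (matrix_exp_deriv X H \<bullet> G)"
    by (intro bounded_linear.sums[OF bounded_linear_inner_left] matrix_exp_deriv_sums)
  show "(\<lambda>k. ((1 / fact k) *\<^sub>R matrix_power_deriv k X H) \<bullet> G)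
      sums (H \<bullet> matrix_exp_deriv (transpose X) G)"
    using bounded_linear.sums[OF bounded_linear_inner_right matrix_exp_deriv_sums,
        of H "transpose X" G]
    by (simp add: inner_matrix_power_deriv)
qed

text \<open>\<open>gradient\<close> and \<open>frechet_derivative\<close> are description operators;
  the differentiability claims ensure that the equation speaks of actual derivatives.\<close>

theorem proposition6p1:
  fixes f :: "real^'n^'n \<Rightarrow> real" and A :: "real^'n^'n"
  assumes "\<And>X. f differentiable (at X)"
  shows "(f \<circ> matrix_exp) differentiable (at A)
    \<and> matrix_exp differentiable (at (transpose A))
    \<and> gradient (f \<circ> matrix_exp) A =
        frechet_derivative matrix_exp (at (transpose A)) (gradient f (matrix_exp A))"
proof (intro conjI)
  let ?G = "gradient f (matrix_exp A)"
  have "(f has_derivative (\<lambda>h. h \<bullet> ?G)) (at (matrix_exp A))"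
    using GDERIV_gradient[OF assms] by (simp add: gderiv_def)
  \<comment> \<open>The chain rule gives the differential
    \<open>h \<mapsto> matrix_exp_deriv A h \<bullet> ?G\<close>; moving the operator to the other
    argument exhibits the gradient.\<close>
  from diff_chain_at[OF has_derivative_matrix_exp this]
  have comp: "GDERIV (f \<circ> matrix_exp) A :> matrix_exp_deriv (transpose A) ?G"
    by (simp add: gderiv_def comp_def inner_matrix_exp_deriv)
  then show "(f \<circ> matrix_exp) differentiable (at A)"
    unfolding gderiv_def by (rule differentiableI)
  show "matrix_exp differentiable (at (transpose A))"
    by (rule differentiableI[OF has_derivative_matrix_exp])
  show "gradient (f \<circ> matrix_exp) A =
      frechet_derivative matrix_exp (at (transpose A)) ?G"
    using gradient_eqI[OF comp] frechet_derivative_at[OF has_derivative_matrix_exp] by metis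
qed

end
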